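(* Let $\theta\in[0,\pi/4]$, $c=\cos\theta$, $s=\sin\theta$, and $K(\theta)=\lceil (sc+1)/(2sc)\rceil-1$. Then $\xi=re^{\mathrm{i}\theta}$ (with $r>1$) has a square digit set if and only if $$r\in\bigcup_{N=1}^{K(\theta)}\bigl((2N-1)(c+s),\,u_N(\theta)\bigr],\qquad u_N(\theta)=\frac{2N+1}{c+s}.$$
   Context: $\mathcal{L}=\mathbb{Z}[\mathrm{i}]$, $\mathcal{X}=\{a+b\mathrm{i}:a,b\in[-1/2,1/2)\}$. For $z\in\mathcal{X}$ let $d(z)$ be the unique element of $\mathcal{L}$ with $\xi z-d(z)\in\mathcal{X}$; the digit set is $\mathcal{D}=\{d(z):z\in\mathcal{X}\}$. $\xi$ has a square digit set if $\mathcal{D}=\{a+b\mathrm{i}:a,b\in\mathbb{Z},\ |a|,|b|\le N\}$ for some $N\in\mathbb{N}$. Convention: for $\theta=0$ (where $sc=0$), $K(0)=\infty$, i.e. the union is over all $N\ge1$. *)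

theory Defs
  imports Complex_Main "HOL-Library.Extended_Real"
begin

definition gauss_int :: "complex set" where
  "gauss_int = {of_int a + of_int b * \<i> | a b :: int. True}"

definition fund_square :: "complex set" where
  "fund_square = {of_real a + of_real b * \<i> | a b :: real. a \<in> {-1/2..<1/2} \<and> b \<in> {-1/2..<1/2}}"

text \<open>The description in \<open>digit\<close> is proper: every complex number has exactly one
  translate by a Gaussian integer in the fundamental square.\<close>

lemma gauss_int_translate_ex1: "\<exists>!d. d \<in> gauss_int \<and> w - d \<in> fund_square"
proof -
  have mem: "w - (of_int a + of_int b * \<i>) \<in> fund_square \<longleftrightarrow>
      a = \<lfloor>Re w + 1/2\<rfloor> \<and> b = \<lfloor>Im w + 1/2\<rfloor>" for a b :: int
  proof -
    have "w - (of_int a + of_int b * \<i>) \<in> fund_square \<longleftrightarrow>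
        Re w - of_int a \<in> {-1/2..<1/2} \<and> Im w - of_int b \<in> {-1/2..<1/2}"
      unfolding fund_square_def by (auto simp: complex_eq_iff)
    also have "\<dots> \<longleftrightarrow> \<lfloor>Re w + 1/2\<rfloor> = a \<and> \<lfloor>Im w + 1/2\<rfloor> = b"
      unfolding floor_eq_iff by auto
    finally show ?thesis by auto
  qed
  show ?thesis
    by (rule ex1I[of _ "of_int \<lfloor>Re w + 1/2\<rfloor> + of_int \<lfloor>Im w + 1/2\<rfloor> * \<i>"])
      (use mem in \<open>auto simp: gauss_int_def\<close>)
qed

definition digit :: "complex \<Rightarrow> complex \<Rightarrow> complex" where
  "digit \<xi> z = (THE d. d \<in> gauss_int \<and> \<xi> * z - d \<in> fund_square)"

definition digit_set :: "complex \<Rightarrow> complex set" where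
  "digit_set \<xi> = {digit \<xi> z | z. z \<in> fund_square}"

definition has_square_digit_set :: "complex \<Rightarrow> bool" where
  "has_square_digit_set \<xi> \<longleftrightarrow> (\<exists>N :: nat.
     digit_set \<xi> = {of_int a + of_int b * \<i> | a b :: int. \<bar>a\<bar> \<le> int N \<and> \<bar>b\<bar> \<le> int N})"

text \<open>Extended-real valued, because \<open>K 0 = \<infinity>\<close> by convention.\<close>

definition K_bound :: "real \<Rightarrow> ereal" where
  "K_bound \<theta> = (if \<theta> = 0 then \<infinity>
     else ereal (of_int (\<lceil>(sin \<theta> * cos \<theta> + 1) / (2 * (sin \<theta> * cos \<theta>))\<rceil> - 1)))"

definition u_bound :: "nat \<Rightarrow> real \<Rightarrow> real" where
  "u_bound N \<theta> = (2 * real N + 1) / (cos \<theta> + sin \<theta>)"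

end

theory Submission
  imports Defs
begin

text \<open>
  A Gaussian integer \<open>m + n\<i>\<close> is a digit iff its unit cell meets the rotated square \<open>\<xi>\<X>\<close>. For an
  \<open>N\<close>-square digit set, the vertex \<open>-(1+\<i>)/2\<close> of \<open>\<X>\<close> forces \<open>r (c+s) \<le> 2N+1\<close>, and the corner
  digit \<open>N + N\<i>\<close> forces \<open>(2N-1)(c+s) < r\<close>. Conversely the first bound puts \<open>\<xi>\<X>\<close> inside the union of
  the cells, and the second makes \<open>\<xi>\<X>\<close> contain a square \<open>[-M,M]\<^sup>2\<close> with \<open>M > N - 1/2\<close>, which meets every cell.
  Finally \<open>N \<le> K(\<theta>)\<close> says exactly that the interval for \<open>N\<close> is nonempty.
\<close>

lemma mem_fund_square_iff:
  "z \<in> fund_square \<longleftrightarrow> Re z \<in> {-1/2..<1/2} \<and> Im z \<in> {-1/2..<1/2}"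
  unfolding fund_square_def by (auto simp: complex_eq_iff)

text \<open>\<open>round\<close> is \<open>floor (x + 1/2)\<close>: ties go up, as the half-open
  cell \<open>[-1/2, 1/2)\<close> requires.\<close>

lemma digit_eq_round: "digit \<xi> z = of_int (round (Re (\<xi> * z))) + of_int (round (Im (\<xi> * z))) * \<i>"
  unfolding digit_def
proof (rule the1_equality[OF gauss_int_translate_ex1], intro conjI)
  show "of_int (round (Re (\<xi> * z))) + of_int (round (Im (\<xi> * z))) * \<i> \<in> gauss_int"
    unfolding gauss_int_def by blast
  have *: "-1/2 \<le> x - of_int (round x) \<and> x - of_int (round x) < 1/2" for x :: real
    unfolding round_def by linarith
  show "\<xi> * z - (of_int (round (Re (\<xi> * z))) + of_int (round (Im (\<xi> * z))) * \<i>) \<in> fund_square"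
    unfolding mem_fund_square_iff using *[of "Re (\<xi> * z)"] *[of "Im (\<xi> * z)"] by simp
qed

lemma mem_digit_set_iff:
  assumes "\<xi> \<noteq> 0"
  shows "of_int m + of_int n * \<i> \<in> digit_set \<xi> \<longleftrightarrow>
    (\<exists>w. round (Re w) = m \<and> round (Im w) = n \<and> w / \<xi> \<in> fund_square)" (is "?L \<longleftrightarrow> ?R")
proof
  assume ?L
  then obtain z where z: "z \<in> fund_square" "of_int m + of_int n * \<i> = digit \<xi> z"
    unfolding digit_set_def by blast
  then have "round (Re (\<xi> * z)) = m \<and> round (Im (\<xi> * z)) = n"
    unfolding digit_eq_round by (simp add: complex_eq_iff)
  with z assms show ?R by (intro exI[of _ "\<xi> * z"]) simp
next
  assume ?R
  then obtain w where w: "round (Re w) = m" "round (Im w) = n" "w / \<xi> \<in> fund_square" by blast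
  have "digit \<xi> (w / \<xi>) = of_int m + of_int n * \<i>"
    unfolding digit_eq_round using w assms by simp
  with w(3) show ?L unfolding digit_set_def by force
qed

text \<open>Dividing by \<xi> rotates by -\<theta> and scales by \<open>1/r\<close>, so membership
  of \<open>x + y*\<i>\<close> in the image of the square becomes two linear conditions.\<close>

lemma mem_digit_set_polar_iff:
  assumes "r > 0"
  shows "of_int m + of_int n * \<i> \<in> digit_set (of_real r * exp (\<i> * of_real \<theta>)) \<longleftrightarrow>
    (\<exists>x y. round x = m \<and> round y = n \<and>
      x * cos \<theta> + y * sin \<theta> \<in> {-r/2..<r/2} \<and> y * cos \<theta> - x * sin \<theta> \<in> {-r/2..<r/2})"
proof -
  have inv: "w / (of_real r * exp (\<i> * of_real \<theta>)) = (w * cis (-\<theta>)) / of_real r" for w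
    using assms by (simp add: cis_conv_exp exp_minus field_simps)
  have "w / (of_real r * exp (\<i> * of_real \<theta>)) \<in> fund_square \<longleftrightarrow>
      Re w * cos \<theta> + Im w * sin \<theta> \<in> {-r/2..<r/2} \<and>
      Im w * cos \<theta> - Re w * sin \<theta> \<in> {-r/2..<r/2}" for w
    unfolding inv mem_fund_square_iff using assms by (auto simp: field_simps)
  then show ?thesis
    using assms by (subst mem_digit_set_iff) (auto, metis complex.sel)
qed

lemma digit_set_subset_gauss_int: "digit_set \<xi> \<subseteq> gauss_int"
  unfolding digit_set_def gauss_int_def digit_eq_round by blast

text \<open>Both sets consist of Gaussian integers, so comparing them at every pair of integer
  coordinates suffices.\<close>

lemma digit_set_eq_square_iff:
  fixes N :: nat
  shows "digit_set \<xi> = {of_int a + of_int b * \<i> | a b :: int. \<bar>a\<bar> \<le> int N \<and> \<bar>b\<bar> \<le> int N} \<longleftrightarrow>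
    (\<forall>m n. of_int m + of_int n * \<i> \<in> digit_set \<xi> \<longleftrightarrow> \<bar>m\<bar> \<le> int N \<and> \<bar>n\<bar> \<le> int N)"
    (is "_ = ?S \<longleftrightarrow> _")
proof -
  have S: "of_int m + of_int n * \<i> \<in> ?S \<longleftrightarrow> \<bar>m\<bar> \<le> int N \<and> \<bar>n\<bar> \<le> int N" for m n
    by (auto simp: complex_eq_iff)
  have sub: "?S \<subseteq> gauss_int" unfolding gauss_int_def by blast
  have "digit_set \<xi> = ?S \<longleftrightarrow>
      (\<forall>m n. of_int m + of_int n * \<i> \<in> digit_set \<xi> \<longleftrightarrow> of_int m + of_int n * \<i> \<in> ?S)"
  proof (rule iffI, simp, rule set_eqI)
    fix z
    assume eq: "\<forall>m n. of_int m + of_int n * \<i> \<in> digit_set \<xi> \<longleftrightarrow> of_int m + of_int n * \<i> \<in> ?S"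
    show "z \<in> digit_set \<xi> \<longleftrightarrow> z \<in> ?S"
    proof (cases "z \<in> gauss_int")
      case True
      then obtain m n where "z = of_int m + of_int n * \<i>" unfolding gauss_int_def by blast
      with eq show ?thesis by blast
    next
      case False
      with sub digit_set_subset_gauss_int show ?thesis by blast
    qed
  qed
  then show ?thesis unfolding S .
qed

text \<open>Since ties round up, only the lower endpoint is attained; this is why the vertex bound
  on r is not strict.\<close>

lemma abs_round_le_iff: "\<bar>round x\<bar> \<le> int N \<longleftrightarrow> - real N - 1/2 \<le> x \<and> x < real N + 1/2"
  for x :: real
proof -
  have "\<bar>round x\<bar> \<le> int N \<longleftrightarrow> - int N \<le> \<lfloor>x + 1/2\<rfloor> \<and> \<lfloor>x + 1/2\<rfloor> < int N + 1"
    unfolding round_def by linarith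
  also have "\<dots> \<longleftrightarrow> - real N \<le> x + 1/2 \<and> x + 1/2 < real N + 1"
    unfolding le_floor_iff floor_less_iff by simp
  finally show ?thesis by auto
qed

text \<open>Inner integers represent themselves, and the extremes N and -N are hit by M and -M.
  Strictness of \<open>N - 1/2 < M\<close> matters for -M, as \<open>-N + 1/2\<close> rounds
  up.\<close>

lemma ex_round_eq_of_abs_le:
  fixes M :: real
  assumes "real N - 1/2 < M" "M \<le> real N" "\<bar>m\<bar> \<le> int N" "N \<ge> 1"
  shows "\<exists>x. round x = m \<and> \<bar>x\<bar> \<le> M"
proof -
  consider "\<bar>m\<bar> < int N" | "m = int N" | "m = - int N" using assms by linarith
  then show ?thesis
  proof cases
    case 1
    then have "\<bar>m\<bar> \<le> int N - 1" by simp
    then have "\<bar>real_of_int m\<bar> \<le> real N - 1" by linarith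
    with assms show ?thesis by (intro exI[of _ "of_int m"]) auto
  next
    case 2
    have "round M = m" using assms 2 unfolding round_def by (intro floor_unique) auto
    with assms show ?thesis by (intro exI[of _ M]) auto
  next
    case 3
    have "round (- M) = m" using assms 3 unfolding round_def by (intro floor_unique) auto
    with assms show ?thesis by (intro exI[of _ "-M"]) auto
  qed
qed

lemma cos_pos_sin_nonneg:
  assumes "\<theta> \<in> {0..pi/4}"
  shows "cos \<theta> > 0" and "sin \<theta> \<ge> 0"
  using assms pi_gt_zero
  by (auto intro!: cos_gt_zero_pi sin_ge_zero simp del: pi_gt_zero)

lemma digit_set_polar_eq_square_iff:
  fixes \<theta> r :: real and N :: nat
  assumes th: "\<theta> \<in> {0..pi/4}" and r: "r > 1"
  defines "c \<equiv> cos \<theta>" and "s \<equiv> sin \<theta>"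
  shows "digit_set (of_real r * exp (\<i> * of_real \<theta>)) =
      {of_int a + of_int b * \<i> | a b :: int. \<bar>a\<bar> \<le> int N \<and> \<bar>b\<bar> \<le> int N} \<longleftrightarrow>
    N \<ge> 1 \<and> (2 * real N - 1) * (c + s) < r \<and> r * (c + s) \<le> 2 * real N + 1"
proof -
  have c: "c > 0" unfolding c_def using th by (rule cos_pos_sin_nonneg)
  have s: "s \<ge> 0" unfolding s_def using th by (rule cos_pos_sin_nonneg)
  have cs: "c * c + s * s = 1" unfolding c_def s_def by (simp flip: power2_eq_square)
  have "(c + s)\<^sup>2 = 1 + 2 * (c * s)" using cs by (simp add: power2_eq_square algebra_simps)
  then have "1 \<le> (c + s)\<^sup>2" using c s by simp
  then have cs1: "c + s \<ge> 1" using c s by (intro power2_le_imp_le[of 1 "c + s"]) auto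
  let ?P = "\<lambda>x y. x * c + y * s \<in> {-r/2..<r/2} \<and> y * c - x * s \<in> {-r/2..<r/2}"
  have "digit_set (of_real r * exp (\<i> * of_real \<theta>)) =
      {of_int a + of_int b * \<i> | a b :: int. \<bar>a\<bar> \<le> int N \<and> \<bar>b\<bar> \<le> int N} \<longleftrightarrow>
    (\<forall>m n. (\<exists>x y. round x = m \<and> round y = n \<and> ?P x y) \<longleftrightarrow> \<bar>m\<bar> \<le> int N \<and> \<bar>n\<bar> \<le> int N)"
    unfolding digit_set_eq_square_iff c_def s_def using r
    by (subst mem_digit_set_polar_iff) simp_all
  also have "\<dots> \<longleftrightarrow> N \<ge> 1 \<and> (2 * real N - 1) * (c + s) < r \<and> r * (c + s) \<le> 2 * real N + 1"
    (is "?L \<longleftrightarrow> ?R")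
  proof
    assume L: ?L
    \<comment> \<open>The point is \<xi> times the vertex \<open>-(1+\<i>)/2\<close>, which lies in
      the half-open square.\<close>
    have "?P (- r * (c - s) / 2) (- r * (c + s) / 2)"
    proof -
      have "- r * (c - s) / 2 * c + - r * (c + s) / 2 * s = - r / 2 * (c * c + s * s)"
        "- r * (c + s) / 2 * c - - r * (c - s) / 2 * s = - r / 2 * (c * c + s * s)"
        by (simp_all add: field_simps)
      then show ?thesis using r by (simp add: cs)
    qed
    with L have "\<bar>round (- r * (c + s) / 2)\<bar> \<le> int N" by blast
    then have up: "r * (c + s) \<le> 2 * real N + 1" unfolding abs_round_le_iff by auto
    \<comment> \<open>For N = 0 this would give r \<le> 1.\<close>
    have "r * 1 \<le> r * (c + s)" using cs1 r by (intro mult_left_mono) auto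
    with up r have N: "N \<ge> 1" by (cases N) auto
    \<comment> \<open>A point of the cell of the corner digit, where both coordinates are at least
      \<open>N - 1/2\<close>; the open edge of the square makes the resulting bound strict.\<close>
    from L obtain x y where xy: "round x = int N" "round y = int N" "?P x y" by force
    have "x \<ge> real N - 1/2" "y \<ge> real N - 1/2"
      using xy(1,2) unfolding round_def floor_eq_iff by auto
    then have "(real N - 1/2) * c + (real N - 1/2) * s \<le> x * c + y * s"
      using c s by (intro add_mono mult_right_mono) auto
    with xy(3) have "(real N - 1/2) * c + (real N - 1/2) * s < r / 2" by auto
    then have "(2 * real N - 1) * (c + s) < r" by (simp add: algebra_simps)
    with N up show ?R by blast
  next
    assume R: ?R
    show ?L
    proof (intro allI iffI)
      fix m n assume "\<exists>x y. round x = m \<and> round y = n \<and> ?P x y"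
      then obtain x y where xy: "round x = m" "round y = n" "?P x y" by blast
      \<comment> \<open>Coordinates in the frame of the rotated square; rotating back recovers x and
        y.\<close>
      define u v where "u = x * c + y * s" and "v = y * c - x * s"
      have uv: "-r/2 \<le> u" "u < r/2" "-r/2 \<le> v" "v < r/2" using xy(3) by (auto simp: u_def v_def)
      have "u * c - v * s = x * (c * c + s * s)" "u * s + v * c = y * (c * c + s * s)"
        by (simp_all add: u_def v_def algebra_simps)
      then have x: "x = u * c - v * s" and y: "y = u * s + v * c" by (simp_all add: cs)
      \<comment> \<open>Strictness survives multiplication by c > 0 but not by s, which may vanish.
        One strict summand suffices for the strict upper bounds on x and y.\<close>
      have "u * c < r/2 * c" "-r/2 * c \<le> u * c" "u * s \<le> r/2 * s" "-r/2 * s \<le> u * s"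
        "v * c < r/2 * c" "-r/2 * c \<le> v * c" "v * s \<le> r/2 * s" "-r/2 * s \<le> v * s"
        by (rule mult_right_mono mult_strict_right_mono; use uv c s in linarith)+
      then have "x < r/2 * c + r/2 * s" "- (r/2 * c + r/2 * s) \<le> x"
        "y < r/2 * c + r/2 * s" "- (r/2 * c + r/2 * s) \<le> y"
        unfolding x y by linarith+
      moreover have "r/2 * c + r/2 * s \<le> real N + 1/2" using R by (simp add: algebra_simps)
      ultimately show "\<bar>m\<bar> \<le> int N \<and> \<bar>n\<bar> \<le> int N"
        unfolding xy(1,2)[symmetric] abs_round_le_iff by auto
    next
      fix m n assume mn: "\<bar>m\<bar> \<le> int N \<and> \<bar>n\<bar> \<le> int N"
      \<comment> \<open>M must exceed \<open>N - 1/2\<close> to reach the outer cells, stay below N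
        to round to N, and satisfy \<open>M * (c + s) < r/2\<close> to keep the square of half-side
        M off the open edges.\<close>
      have "real N - 1/2 < r / (2 * (c + s))" using R cs1 by (simp add: field_simps)
      then have "real N - 1/2 < min (real N) (r / (2 * (c + s)))" by simp
      then obtain M where M: "real N - 1/2 < M" "M < real N" "M < r / (2 * (c + s))"
        using dense by (metis min_less_iff_conj)
      have Mr: "M * c + M * s < r / 2" using M(3) cs1 by (simp add: field_simps)
      obtain x y where x: "round x = m" "\<bar>x\<bar> \<le> M" and y: "round y = n" "\<bar>y\<bar> \<le> M"
        using ex_round_eq_of_abs_le[of N M] M R mn by (meson less_imp_le)
      have "\<bar>x * c\<bar> \<le> M * c" "\<bar>y * s\<bar> \<le> M * s" "\<bar>y * c\<bar> \<le> M * c" "\<bar>x * s\<bar> \<le> M * s"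
        using x y c s by (auto simp: abs_mult intro!: mult_right_mono)
      then have "?P x y" using Mr unfolding atLeastLessThan_iff by linarith
      with x y show "\<exists>x y. round x = m \<and> round y = n \<and> ?P x y" by blast
    qed
  qed
  finally show ?thesis .
qed

text \<open>Multiplying by \<open>c + s\<close> and using \<open>(c + s)^2 = 1 + 2*s*c\<close>
  reduces nonemptiness of the interval to \<open>2*N*s*c < s*c + 1\<close>. At \<theta> = 0 this
  always holds, matching the infinite bound.\<close>

lemma le_K_bound_iff:
  fixes \<theta> :: real and N :: nat
  assumes th: "\<theta> \<in> {0..pi/4}"
  shows "ereal (real N) \<le> K_bound \<theta> \<longleftrightarrow> (2 * real N - 1) * (cos \<theta> + sin \<theta>) < u_bound N \<theta>"
proof -
  define c s where "c = cos \<theta>" and "s = sin \<theta>"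
  have c: "c > 0" unfolding c_def using th by (rule cos_pos_sin_nonneg)
  have s: "s \<ge> 0" unfolding s_def using th by (rule cos_pos_sin_nonneg)
  have "c * c + s * s = 1" unfolding c_def s_def by (simp flip: power2_eq_square)
  then have sq: "(c + s) * (c + s) = 1 + 2 * (s * c)" by (simp add: algebra_simps)
  have "(2 * real N - 1) * (c + s) < u_bound N \<theta> \<longleftrightarrow>
      (2 * real N - 1) * ((c + s) * (c + s)) < 2 * real N + 1"
    unfolding u_bound_def c_def[symmetric] s_def[symmetric]
    using c s by (simp add: pos_less_divide_eq mult.assoc)
  also have "\<dots> \<longleftrightarrow> real N * (2 * (s * c)) < s * c + 1"
    unfolding sq by (auto simp: algebra_simps)
  also have "\<dots> \<longleftrightarrow> ereal (real N) \<le> K_bound \<theta>"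
  proof (cases "\<theta> = 0")
    case True
    then show ?thesis by (simp add: K_bound_def s_def)
  next
    case False
    then have "s > 0" unfolding s_def using th by (intro sin_gt_zero) auto
    with c have "real N * (2 * (s * c)) < s * c + 1 \<longleftrightarrow> real N < (s * c + 1) / (2 * (s * c))"
      by (simp add: pos_less_divide_eq)
    \<comment> \<open>\<open>\<lceil>t\<rceil> - 1\<close> is the largest integer strictly below
      t.\<close>
    also have "\<dots> \<longleftrightarrow> int N < \<lceil>(s * c + 1) / (2 * (s * c))\<rceil>"
      by (simp add: less_ceiling_iff)
    also have "\<dots> \<longleftrightarrow> real N \<le> of_int (\<lceil>(s * c + 1) / (2 * (s * c))\<rceil> - 1)"
      by linarith
    finally show ?thesis using False by (simp add: K_bound_def s_def c_def)
  qed
  finally show ?thesis by (simp add: c_def s_def)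
qed

theorem theorem3p4:
  fixes \<theta> r :: real
  assumes "\<theta> \<in> {0..pi/4}" and "r > 1"
  shows "has_square_digit_set (of_real r * exp (\<i> * of_real \<theta>)) \<longleftrightarrow>
    r \<in> (\<Union>N \<in> {N :: nat. 1 \<le> N \<and> ereal (real N) \<le> K_bound \<theta>}.
           {(2 * real N - 1) * (cos \<theta> + sin \<theta>) <.. u_bound N \<theta>})"
proof -
  have "r * (cos \<theta> + sin \<theta>) \<le> 2 * real N + 1 \<longleftrightarrow> r \<le> u_bound N \<theta>" for N
    unfolding u_bound_def using cos_pos_sin_nonneg[OF assms(1)] by (simp add: pos_le_divide_eq)
  \<comment> \<open>Any r meeting both bounds makes the interval for its N nonempty, so N lies in
    the index range of the union.\<close>
  then show ?thesis
    unfolding has_square_digit_set_def digit_set_polar_eq_square_iff[OF assms]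
    using le_K_bound_iff[OF assms(1)] by force
qed

end
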